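(* Let $\alpha\in(0,1]$, let $N_1,N_2,\beta_1,\beta_2,\varepsilon$ be positive constants, and set $$\theta:=\varepsilon\Big(\frac{N_1}{\beta_1}+\frac{N_2}{\beta_2}\Big),\qquad K_i:=\frac{N_i}{1-\theta},\qquad \lambda_i:=\beta_i-\frac{\varepsilon N_i}{1-\theta},\quad i=1,2.$$ Assume $\theta<1$. (i) If $t_0\ge0$ and $u:[t_0,+\infty)\to[0,\infty)$ is bounded, continuous and satisfies, for all $t\ge t_0$, $$u(t)\le N_1\frac{E_\alpha(\beta_1,t_0)}{E_\alpha(\beta_1,t)}+\frac{\varepsilon N_1}{E_\alpha(\beta_1,t)}\int_{t_0}^t|s|^{\alpha-1}E_\alpha(\beta_1,s)u(s)\,ds+\varepsilon N_2E_\alpha(\beta_2,t)\int_t^{+\infty}|s|^{\alpha-1}\frac{u(s)}{E_\alpha(\beta_2,s)}\,ds,$$ then $u(t)\le K_1\dfrac{E_\alpha(\lambda_1,t_0)}{E_\alpha(\lambda_1,t)}$ for all $t\ge t_0$. (ii) If $t_0\le0$ and $u:(-\infty,t_0]\to[0,\infty)$ is bounded, continuous and satisfies, for all $t\le t_0$, $$u(t)\le N_2\frac{E_\alpha(\beta_2,t)}{E_\alpha(\beta_2,t_0)}+\varepsilon N_2E_\alpha(\beta_2,t)\int_t^{t_0}|s|^{\alpha-1}\frac{u(s)}{E_\alpha(\beta_2,s)}\,ds+\frac{\varepsilon N_1}{E_\alpha(\beta_1,t)}\int_{-\infty}^t|s|^{\alpha-1}E_\alpha(\beta_1,s)u(s)\,ds,$$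 then $u(t)\le K_2\dfrac{E_\alpha(\lambda_2,t)}{E_\alpha(\lambda_2,t_0)}$ for all $t\le t_0$.
   Context: $E_\alpha(\lambda,t):=\exp(\lambda t^\alpha/\alpha)$ for $t\ge0$ and $E_\alpha(\lambda,t):=\exp(-\lambda(-t)^\alpha/\alpha)$ for $t\le0$, for $\lambda\in\mathbb{R}$. *)

theory Defs
  imports "HOL-Analysis.Analysis"
begin

(* For \<alpha> > 0 both branches of the paper's definition give 1 at t = 0. *)
definition E_conf :: "real \<Rightarrow> real \<Rightarrow> real \<Rightarrow> real" where
  "E_conf \<alpha> l t =
     (if t \<ge> 0 then exp (l * t powr \<alpha> / \<alpha>)
      else exp (- l * (- t) powr \<alpha> / \<alpha>))"

(* The kernel |s|^(\<alpha>-1) is written \<bar>s\<bar> powr (\<alpha> - 1).  At s = 0 powr returns 0, also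
   for \<alpha> = 1; this changes the integrand at a single point only. *)

end

theory Submission
  imports Defs
begin

text \<open>Let \<open>V\<close> be the supremum of \<open>u\<close> over \<open>[t, \<infinity>)\<close>. Estimating \<open>u\<close> at an arbitrary
  \<open>r \<ge> t\<close>, with \<open>u \<le> V\<close> in both integrals beyond \<open>t\<close>, and then taking the supremum
  over \<open>r\<close> moves \<open>\<theta> V\<close> to the left-hand side:
  \<open>(1 - \<theta>) u(t)\<close> is bounded by the first two terms of the hypothesis alone. Gronwall's argument
  in the variable \<open>t\<^sup>\<alpha> / \<alpha>\<close> then gives (i). The substitution \<open>t \<mapsto> -t\<close> exchanges the two
  indices and reduces (ii) to (i).\<close>

section \<open>Integrals over half-lines\<close>

text \<open>An integral over a half-line is approximated by integrals over large compact intervals.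
  The case of a function that is not integrable on \<open>{a..}\<close> is included: its integral is
  0 by convention, and \<open>0 \<le> B\<close> covers it.\<close>

lemma integral_atLeast_le:
  fixes f :: "real \<Rightarrow> real"
  assumes "0 \<le> B"
    and le: "\<And>b. a \<le> b \<Longrightarrow> f integrable_on {a..b} \<Longrightarrow> integral {a..b} f \<le> B"
  shows "integral {a..} f \<le> B"
proof (cases "f integrable_on {a..}")
  case False
  then show ?thesis using \<open>0 \<le> B\<close> by (simp add: not_integrable_integral)
next
  case True
  let ?g = "\<lambda>x. if x \<in> {a..} then f x else 0"
  show ?thesis
  proof (rule field_le_epsilon)
    fix e :: real assume "0 < e"
    have "(f has_integral integral {a..} f) {a..}" using True by blast
    then obtain C where "C > 0" and C: "\<And>c d. ball 0 C \<subseteq> cbox c d \<Longrightarrow>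
          norm (integral (cbox c d) ?g - integral {a..} f) < e"
      using \<open>0 < e\<close> unfolding has_integral_alt'[of f _ "{a..}"] by meson
    \<comment> \<open>Large enough that \<open>{-b..b}\<close> contains the ball of radius
      \<open>C\<close> and that \<open>-b\<close> lies below \<open>a\<close>, so the box cuts
      \<open>{a..}\<close> down to exactly \<open>{a..b}\<close>.\<close>
    define b where "b = \<bar>a\<bar> + C"
    have "a \<le> b" using \<open>C > 0\<close> by (simp add: b_def)
    have "ball 0 C \<subseteq> cbox (-b) b" by (auto simp: b_def)
    from C[OF this] have 1: "\<bar>integral {-b..b} ?g - integral {a..} f\<bar> < e" by simp
    have "{a..} \<inter> {-b..b} = {a..b}" using \<open>C > 0\<close> by (auto simp: b_def)
    then have 2: "integral {-b..b} ?g = integral {a..b} f"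
      by (simp only: integral_restrict_Int)
    have "f integrable_on {a..b}"
      using integrable_on_subinterval[OF True] by auto
    from le[OF \<open>a \<le> b\<close> this] 1 2 show "integral {a..} f \<le> B + e" by linarith
  qed
qed

text \<open>For nonnegative functions integrability and absolute integrability coincide, so the
  reflection rule for absolute integrals applies. If one side is not integrable, neither is the
  other, and both integrals are 0 by convention.\<close>

lemma integral_reflect_atMost_nonneg:
  fixes f :: "real \<Rightarrow> real"
  assumes nonneg: "\<And>s. s \<le> a \<Longrightarrow> 0 \<le> f s"
  shows "integral {-a..} (\<lambda>s. f (- s)) = integral {..a} f"
proof -
  have iff: "(\<lambda>s. f (- s)) absolutely_integrable_on {-a..} \<and> integral {-a..} (\<lambda>s. f (- s)) = b \<longleftrightarrow>
      f absolutely_integrable_on {..a} \<and> integral {..a} f = b" for b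
    by (rule has_absolute_integral_reflect_real) auto
  have "f absolutely_integrable_on {..a} \<longleftrightarrow> f integrable_on {..a}"
    and "(\<lambda>s. f (- s)) absolutely_integrable_on {-a..} \<longleftrightarrow> (\<lambda>s. f (- s)) integrable_on {-a..}"
    using nonneg by (auto intro!: absolutely_integrable_on_iff_nonneg)
  with iff show ?thesis by (metis not_integrable_integral)
qed

section \<open>Integrals against the kernel \<open>\<bar>s\<bar> powr (a - 1)\<close>\<close>

lemma has_real_derivative_powr_div:
  fixes a s :: real
  assumes "0 < a" "0 < s"
  shows "((\<lambda>s. s powr a / a) has_real_derivative \<bar>s\<bar> powr (a - 1)) (at s)"
  using assms by (auto intro!: derivative_eq_intros)

lemma continuous_on_powr_div:
  fixes a c d :: real
  assumes "0 < a" "0 \<le> c"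
  shows "continuous_on {c..d} (\<lambda>s. s powr a / a)"
  using assms by (intro continuous_intros continuous_on_powr') auto

lemma has_integral_kernel_exp:
  fixes a c p q :: real
  assumes "0 < a" "0 \<le> p" "p \<le> q" "c \<noteq> 0"
  shows "((\<lambda>s. \<bar>s\<bar> powr (a - 1) * exp (c * (s powr a / a))) has_integral
     (exp (c * (q powr a / a)) / c - exp (c * (p powr a / a)) / c)) {p..q}"
\<comment> \<open>For \<open>p = 0\<close> the kernel may be singular at the left endpoint; the
  interior form asks only for continuity of the primitive there.\<close>
proof (rule fundamental_theorem_of_calculus_interior[OF \<open>p \<le> q\<close>])
  show "continuous_on {p..q} (\<lambda>s. exp (c * (s powr a / a)) / c)"
    using assms by (intro continuous_intros continuous_on_powr_div) auto
next
  fix s assume "s \<in> {p<..<q}"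
  then have "((\<lambda>s. exp (c * (s powr a / a)) / c) has_real_derivative
     exp (c * (s powr a / a)) * (c * \<bar>s\<bar> powr (a - 1)) / c) (at s)"
    using assms by (intro DERIV_cdivide DERIV_fun_exp DERIV_cmult has_real_derivative_powr_div) auto
  then show "((\<lambda>s. exp (c * (s powr a / a)) / c) has_vector_derivative
      \<bar>s\<bar> powr (a - 1) * exp (c * (s powr a / a))) (at s)"
    using \<open>c \<noteq> 0\<close> by (simp add: has_real_derivative_iff_has_vector_derivative mult.commute)
qed

text \<open>Continuity alone does not suffice, as the kernel may blow up at 0. But it is nonnegative
  with an explicit finite integral, hence absolutely integrable, and a bounded measurable factor
  preserves this.\<close>

lemma integrable_kernel_times_continuous:
  fixes a p q :: real
  assumes "0 < a" "0 \<le> p" and contf: "continuous_on {p..q} f"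
  shows "(\<lambda>s. \<bar>s\<bar> powr (a - 1) * f s) integrable_on {p..q}"
proof (cases "p \<le> q")
  case True
  have "((\<lambda>s. \<bar>s\<bar> powr (a - 1)) has_integral (q powr a / a - p powr a / a)) {p..q}"
  proof (rule fundamental_theorem_of_calculus_interior[OF True])
    show "continuous_on {p..q} (\<lambda>s. s powr a / a)"
      using assms by (intro continuous_on_powr_div)
    show "((\<lambda>s. s powr a / a) has_vector_derivative \<bar>s\<bar> powr (a - 1)) (at s)"
      if "s \<in> {p<..<q}" for s
      using has_real_derivative_powr_div[of a s] that assms
      by (simp add: has_real_derivative_iff_has_vector_derivative)
  qed
  then have "(\<lambda>s. \<bar>s\<bar> powr (a - 1)) absolutely_integrable_on {p..q}"
    by (intro nonnegative_absolutely_integrable_1) auto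
  moreover have "f \<in> borel_measurable (lebesgue_on {p..q})"
    by (rule continuous_imp_measurable_on_sets_lebesgue[OF contf]) simp
  moreover have "bounded (f ` {p..q})"
    using compact_continuous_image[OF contf] compact_imp_bounded by blast
  ultimately have "(\<lambda>s. f s * \<bar>s\<bar> powr (a - 1)) absolutely_integrable_on {p..q}"
    by (intro absolutely_integrable_bounded_measurable_product_real) auto
  then show ?thesis
    using set_lebesgue_integral_eq_integral(1) by (simp add: mult.commute)
qed auto

text \<open>The weight is nonnegative, so \<open>u\<close> may be replaced by \<open>V\<close>,
  which leaves an explicit integral. Both signs of \<open>c\<close> occur later: \<open>b1\<close>
  for the integral from the past and \<open>- b2\<close> for the one over the future.\<close>

lemma integral_kernel_exp_le:
  fixes a c p q V :: real
  assumes "0 < a" "0 \<le> p" "p \<le> q" "c \<noteq> 0"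
    and int: "(\<lambda>s. \<bar>s\<bar> powr (a - 1) * (exp (c * (s powr a / a)) * u s)) integrable_on {p..q}"
    and V: "\<And>s. p \<le> s \<Longrightarrow> s \<le> q \<Longrightarrow> u s \<le> V"
  shows "integral {p..q} (\<lambda>s. \<bar>s\<bar> powr (a - 1) * (exp (c * (s powr a / a)) * u s))
     \<le> V * (exp (c * (q powr a / a)) / c - exp (c * (p powr a / a)) / c)"
proof -
  note hi = has_integral_mult_right[OF has_integral_kernel_exp[OF assms(1-4)], of V]
  have "\<bar>s\<bar> powr (a - 1) * (exp (c * (s powr a / a)) * u s) \<le>
      V * (\<bar>s\<bar> powr (a - 1) * exp (c * (s powr a / a)))" if "s \<in> {p..q}" for s
    using mult_left_mono[OF V[of s], of "\<bar>s\<bar> powr (a - 1) * exp (c * (s powr a / a))"] that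
    by (simp add: ac_simps)
  then show ?thesis
    using integral_le[OF int has_integral_integrable[OF hi]] unfolding integral_unique[OF hi] by blast
qed

section \<open>Gronwall inequality for the kernel\<close>

text \<open>With \<open>g\<close> the integral on the right and
  \<open>\<phi> = s powr a / a\<close>, the hypothesis says that \<open>A + e * g\<close> has
  derivative at most \<open>e * K * \<phi>'\<close> times itself. Multiplying by the integrating
  factor \<open>exp (- (e * K) * \<phi>)\<close> therefore gives a nonincreasing function.\<close>

lemma gronwall_kernel:
  fixes a b A K e t0 t :: real
  assumes "0 < a" "0 \<le> t0" "t0 \<le> t" "0 \<le> e"
    and contu: "continuous_on {t0..t} u"
    and u: "\<And>s. t0 \<le> s \<Longrightarrow> s \<le> t \<Longrightarrow> exp (b * (s powr a / a)) * u s \<le>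
       K * (A + e * integral {t0..s} (\<lambda>s. \<bar>s\<bar> powr (a - 1) * (exp (b * (s powr a / a)) * u s)))"
    and "0 \<le> K"
  shows "exp (b * (t powr a / a)) * u t \<le> K * (A * exp (e * K * (t powr a / a - t0 powr a / a)))"
proof -
  let ?\<phi> = "\<lambda>s. s powr a / a"
  let ?f = "\<lambda>s. \<bar>s\<bar> powr (a - 1) * (exp (b * ?\<phi> s) * u s)"
  define g where "g = (\<lambda>s. integral {t0..s} ?f)"
  define h where "h = (\<lambda>s. (A + e * g s) * exp (- (e * K) * ?\<phi> s))"
  have intf: "?f integrable_on {t0..t}"
    using assms by (intro integrable_kernel_times_continuous continuous_intros continuous_on_powr') auto
  then have contg: "continuous_on {t0..t} g"
    unfolding g_def by (rule indefinite_integral_continuous_1)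
  have "h t \<le> h t0"
  \<comment> \<open>Differentiation is confined to the open interval, since \<open>?\<phi>\<close>
    may fail to be differentiable at \<open>t0 = 0\<close>.\<close>
  proof (rule DERIV_nonpos_imp_decreasing_open[OF \<open>t0 \<le> t\<close>])
    show "continuous_on {t0..t} h"
      unfolding h_def using assms
      by (intro continuous_intros contg continuous_on_powr') auto
  next
    fix s assume s: "t0 < s" "s < t"
    have at: "at s within {t0..t} = at s"
      using s by (intro at_within_interior) auto
    have "isCont u s"
      using continuous_on_interior[OF contu] s by simp
    then have "isCont ?f s"
      using s assms by (intro continuous_intros) auto
    then have "(g has_vector_derivative ?f s) (at s within {t0..t})"
      using integral_has_vector_derivative_continuous_at[OF intf, of s "{}"] s
      by (simp add: g_def continuous_at_imp_continuous_within)
    then have dg: "(g has_real_derivative ?f s) (at s)"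
      by (simp add: at has_real_derivative_iff_has_vector_derivative)
    have d\<phi>: "(?\<phi> has_real_derivative \<bar>s\<bar> powr (a - 1)) (at s)"
      using s assms by (intro has_real_derivative_powr_div) auto
    have "((\<lambda>s. exp (- (e * K) * ?\<phi> s)) has_real_derivative
        exp (- (e * K) * ?\<phi> s) * (- (e * K) * \<bar>s\<bar> powr (a - 1))) (at s)"
      by (intro DERIV_fun_exp DERIV_cmult d\<phi>)
    moreover have "((\<lambda>s. A + e * g s) has_real_derivative e * ?f s) (at s)"
      using DERIV_add[OF DERIV_const DERIV_cmult[OF dg, of e], of A] by simp
    ultimately have "(h has_real_derivative e * ?f s * exp (- (e * K) * ?\<phi> s) +
        exp (- (e * K) * ?\<phi> s) * (- (e * K) * \<bar>s\<bar> powr (a - 1)) * (A + e * g s)) (at s)"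
      unfolding h_def by (intro DERIV_mult)
    \<comment> \<open>The derivative factors into a nonnegative weight times the difference of the
      two sides of the hypothesis \<open>u\<close>.\<close>
    moreover have "e * ?f s * exp (- (e * K) * ?\<phi> s) +
        exp (- (e * K) * ?\<phi> s) * (- (e * K) * \<bar>s\<bar> powr (a - 1)) * (A + e * g s)
       = e * exp (- (e * K) * ?\<phi> s) * \<bar>s\<bar> powr (a - 1) *
          (exp (b * ?\<phi> s) * u s - K * (A + e * g s))"
      by (simp add: algebra_simps)
    moreover have "\<dots> \<le> 0"
      using u[of s] s \<open>0 \<le> e\<close> unfolding g_def by (intro mult_nonneg_nonpos) auto
    ultimately show "\<exists>y. (h has_real_derivative y) (at s) \<and> y \<le> 0" by auto
  qed
  \<comment> \<open>Here \<open>g t0 = 0\<close>, so \<open>h t0\<close> reduces to \<open>A\<close>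
    times the integrating factor.\<close>
  then have "(A + e * g t) * exp (- (e * K) * ?\<phi> t) * exp (e * K * ?\<phi> t)
      \<le> A * exp (- (e * K) * ?\<phi> t0) * exp (e * K * ?\<phi> t)"
    by (intro mult_right_mono) (auto simp: h_def g_def)
  then have "A + e * g t \<le> A * exp (e * K * (?\<phi> t - ?\<phi> t0))"
    by (simp add: mult.assoc flip: exp_add) (simp add: algebra_simps)
  then have "K * (A + e * g t) \<le> K * (A * exp (e * K * (?\<phi> t - ?\<phi> t0)))"
    using \<open>0 \<le> K\<close> by (rule mult_left_mono)
  with u[of t] \<open>t0 \<le> t\<close> show ?thesis by (simp add: g_def)
qed

section \<open>Exponential form and reflection of \<open>E_conf\<close>\<close>

lemma E_conf_eq_exp: "0 \<le> t \<Longrightarrow> E_conf a l t = exp (l * (t powr a / a))"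
  by (simp add: E_conf_def)

text \<open>The two branches are reciprocal under reflection, and at 0 both sides are 1 because
  \<open>0 powr a = 0\<close>. This symmetry carries the backward inequality into the forward
  one.\<close>

lemma E_conf_minus: "E_conf a l (- t) = 1 / E_conf a l t"
  by (auto simp: E_conf_def exp_minus field_simps)

lemma E_conf_pos: "0 < E_conf a l t"
  by (simp add: E_conf_def)

section \<open>Decay on a right half-line\<close>

lemma forward_decay:
  fixes a N1 N2 b1 b2 e \<theta> t0 t :: real
  assumes a: "0 < a" and N: "0 < N1" "0 < N2" and b: "0 < b1" "0 < b2" and e: "0 < e"
    and \<theta>: "\<theta> = e * (N1 / b1 + N2 / b2)" "\<theta> < 1"
    and t0: "0 \<le> t0"
    and nonneg: "\<And>t. t0 \<le> t \<Longrightarrow> 0 \<le> u t"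
    and bdd: "bounded (u ` {t0..})" and contu: "continuous_on {t0..} u"
    and ineq: "\<And>t. t0 \<le> t \<Longrightarrow> u t \<le>
            N1 * (E_conf a b1 t0 / E_conf a b1 t)
          + e * N1 / E_conf a b1 t *
              integral {t0..t} (\<lambda>s. \<bar>s\<bar> powr (a - 1) * E_conf a b1 s * u s)
          + e * N2 * E_conf a b2 t *
              integral {t..} (\<lambda>s. \<bar>s\<bar> powr (a - 1) * (u s / E_conf a b2 s))"
    and t: "t0 \<le> t"
  shows "u t \<le> N1 / (1 - \<theta>) *
    (E_conf a (b1 - e * N1 / (1 - \<theta>)) t0 / E_conf a (b1 - e * N1 / (1 - \<theta>)) t)"
proof -
  let ?\<phi> = "\<lambda>s. s powr a / a"
  let ?f = "\<lambda>s. \<bar>s\<bar> powr (a - 1) * (exp (b1 * ?\<phi> s) * u s)"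
  let ?k = "\<lambda>s. \<bar>s\<bar> powr (a - 1) * (exp (- b2 * ?\<phi> s) * u s)"
  define K where "K = N1 / (1 - \<theta>)"
  have "0 \<le> K" using N \<theta> by (simp add: K_def)
  have bddab: "bdd_above (u ` {r..})" if "t0 \<le> r" for r
    using bdd that by (intro bdd_above_mono[OF bounded_imp_bdd_above[OF bdd]] image_mono) auto
  have intf: "?f integrable_on {p..q}" if "t0 \<le> p" for p q
    using that a t0 contu
    by (intro integrable_kernel_times_continuous continuous_intros continuous_on_powr'
          continuous_on_subset[OF contu]) auto
  \<comment> \<open>This eliminates the integral over the future: only values of \<open>u\<close> on
    \<open>{t0..t}\<close> remain on the right, as Gronwall's argument requires.\<close>
  have key: "(1 - \<theta>) * u t \<le> N1 * exp (b1 * (?\<phi> t0 - ?\<phi> t)) +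
      e * N1 * exp (- b1 * ?\<phi> t) * integral {t0..t} ?f" (is "_ \<le> ?R") if t: "t0 \<le> t" for t
  proof -
    \<comment> \<open>Boundedness of \<open>u\<close> makes this a genuine real supremum. It need
      not be attained, so the estimate is made at every \<open>r\<close> beyond
      \<open>t\<close>.\<close>
    define V where "V = (SUP s\<in>{t..}. u s)"
    have uV: "u s \<le> V" if "t \<le> s" for s
      unfolding V_def using that by (intro cSUP_upper bddab t) auto
    then have V0: "0 \<le> V" using nonneg[OF t] by force
    have "u r \<le> ?R + \<theta> * V" if r: "t \<le> r" for r
    proof -
      have r0: "0 \<le> r" "t0 \<le> r" using r t t0 by auto
      have tail: "integral {r..} ?k \<le> V * (exp (- b2 * ?\<phi> r) / b2)"
      proof (rule integral_atLeast_le)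
        show "0 \<le> V * (exp (- b2 * ?\<phi> r) / b2)" using V0 b by simp
      next
        fix q assume q: "r \<le> q" "?k integrable_on {r..q}"
        have "integral {r..q} ?k \<le> V * (exp (- b2 * ?\<phi> q) / (- b2) - exp (- b2 * ?\<phi> r) / (- b2))"
          using q a r0 b uV r by (intro integral_kernel_exp_le) auto
        \<comment> \<open>Dropping the nonpositive contribution of the endpoint \<open>q\<close>
          makes the bound uniform in \<open>q\<close>.\<close>
        also have "\<dots> \<le> V * (exp (- b2 * ?\<phi> r) / b2)"
          using V0 b by (intro mult_left_mono) auto
        finally show "integral {r..q} ?k \<le> V * (exp (- b2 * ?\<phi> r) / b2)" .
      qed
      have "integral {t..r} ?f \<le> V * (exp (b1 * ?\<phi> r) / b1 - exp (b1 * ?\<phi> t) / b1)"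
        using a r t t0 b uV intf[OF t] by (intro integral_kernel_exp_le) auto
      also have "\<dots> \<le> V * (exp (b1 * ?\<phi> r) / b1)"
        using V0 b by (intro mult_left_mono) auto
      finally have mid: "integral {t..r} ?f \<le> V * (exp (b1 * ?\<phi> r) / b1)" .
      have split: "integral {t0..r} ?f = integral {t0..t} ?f + integral {t..r} ?f"
        using Henstock_Kurzweil_Integration.integral_combine[OF t r intf] by simp
      have int0: "0 \<le> integral {t0..t} ?f"
        using intf nonneg by (intro integral_nonneg) auto
      have "integral {t0..r} (\<lambda>s. \<bar>s\<bar> powr (a - 1) * E_conf a b1 s * u s) = integral {t0..r} ?f"
        using t0 by (intro integral_cong) (simp add: E_conf_eq_exp)
      moreover have "integral {r..} (\<lambda>s. \<bar>s\<bar> powr (a - 1) * (u s / E_conf a b2 s)) = integral {r..} ?k"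
        using r0 by (intro integral_cong) (simp add: E_conf_eq_exp exp_minus field_simps)
      ultimately have "u r \<le> N1 * exp (b1 * (?\<phi> t0 - ?\<phi> r))
          + e * N1 * exp (- b1 * ?\<phi> r) * integral {t0..r} ?f
          + e * N2 * exp (b2 * ?\<phi> r) * integral {r..} ?k"
        using ineq[OF \<open>t0 \<le> r\<close>] r0 t0
        by (simp add: E_conf_eq_exp exp_minus exp_diff right_diff_distrib field_simps)
      also have "\<dots> \<le> N1 * exp (b1 * (?\<phi> t0 - ?\<phi> r))
          + e * N1 * exp (- b1 * ?\<phi> r) * (integral {t0..t} ?f + V * (exp (b1 * ?\<phi> r) / b1))
          + e * N2 * exp (b2 * ?\<phi> r) * (V * (exp (- b2 * ?\<phi> r) / b2))"
        unfolding split using mid tail e N by (intro add_mono mult_left_mono) auto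
      \<comment> \<open>The exponentials next to \<open>V\<close> cancel; the stretch from
        \<open>t\<close> to \<open>r\<close> leaves \<open>e * N1 / b1\<close> and the tail
        \<open>e * N2 / b2\<close>, which add up to \<open>\<theta>\<close>.\<close>
      also have "\<dots> = N1 * exp (b1 * (?\<phi> t0 - ?\<phi> r))
          + e * N1 * exp (- b1 * ?\<phi> r) * integral {t0..t} ?f + \<theta> * V"
        using b by (simp add: \<theta> exp_minus field_simps)
      \<comment> \<open>Both remaining exponentials decrease in \<open>r\<close>, and
        \<open>int0\<close> supplies the sign of the integral, so \<open>r\<close> may be replaced
        by \<open>t\<close>. The bound is then independent of \<open>r\<close>.\<close>
      also have "\<dots> \<le> ?R + \<theta> * V"
      proof -
        have "?\<phi> t \<le> ?\<phi> r" using a r t t0 by (intro divide_right_mono powr_mono2) auto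
        then have "b1 * ?\<phi> t \<le> b1 * ?\<phi> r" using b by (intro mult_left_mono) auto
        then show ?thesis
          using e N int0 by (intro add_right_mono add_mono mult_left_mono mult_right_mono) (auto simp: algebra_simps)
      qed
      finally show ?thesis .
    qed
    then have "V \<le> ?R + \<theta> * V" unfolding V_def by (intro cSUP_least) auto
    moreover have "(1 - \<theta>) * u t \<le> (1 - \<theta>) * V"
      using uV[of t] \<theta> by (intro mult_left_mono) auto
    ultimately show ?thesis by (simp add: algebra_simps)
  qed
  \<comment> \<open>Gronwall with \<open>A = exp (b1 * ?\<phi> t0)\<close>, after dividing
    \<open>key\<close> by \<open>1 - \<theta>\<close> and multiplying by
    \<open>exp (b1 * ?\<phi> s)\<close>.\<close>
  have "exp (b1 * ?\<phi> t) * u t \<le> K * (exp (b1 * ?\<phi> t0) * exp (e * K * (?\<phi> t - ?\<phi> t0)))"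
  proof (rule gronwall_kernel)
    fix s assume "t0 \<le> s"
    have "u s \<le> (N1 * exp (b1 * (?\<phi> t0 - ?\<phi> s)) +
      e * N1 * exp (- b1 * ?\<phi> s) * integral {t0..s} ?f) / (1 - \<theta>)"
      using key[OF \<open>t0 \<le> s\<close>] \<theta> by (simp add: pos_le_divide_eq mult.commute)
    also have "\<dots> = exp (- b1 * ?\<phi> s) * (K * (exp (b1 * ?\<phi> t0) + e * integral {t0..s} ?f))"
      unfolding K_def right_diff_distrib exp_diff mult_minus_left exp_minus by (simp add: field_simps)
    finally show "exp (b1 * ?\<phi> s) * u s \<le> K * (exp (b1 * ?\<phi> t0) + e * integral {t0..s} ?f)"
      by (simp add: exp_minus field_simps)
  qed (use a t0 t e \<open>0 \<le> K\<close> continuous_on_subset[OF contu] in auto)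
  then have "u t \<le> exp (- b1 * ?\<phi> t) * (K * (exp (b1 * ?\<phi> t0) * exp (e * K * (?\<phi> t - ?\<phi> t0))))"
    by (simp add: exp_minus field_simps)
  \<comment> \<open>The growth rate \<open>e * K\<close> from Gronwall is subtracted from
    \<open>b1\<close>, which produces the decay rate
    \<open>b1 - e * N1 / (1 - \<theta>)\<close>.\<close>
  moreover have "exp (- b1 * x) * (K * (exp (b1 * y) * exp (e * K * (x - y))))
      = K * exp ((b1 - e * K) * y - (b1 - e * K) * x)" for x y
    by (simp add: mult.left_commute[of _ K] flip: exp_add) (simp add: algebra_simps)
  ultimately have "u t \<le> K * exp ((b1 - e * K) * ?\<phi> t0 - (b1 - e * K) * ?\<phi> t)"
    by (simp only:)
  then show ?thesis
    using t t0 by (simp add: E_conf_eq_exp K_def exp_diff)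
qed

section \<open>Decay on a left half-line by reflection\<close>

lemma backward_decay:
  fixes a N1 N2 b1 b2 e \<theta> t0 t :: real
  assumes a: "0 < a" and N: "0 < N1" "0 < N2" and b: "0 < b1" "0 < b2" and e: "0 < e"
    and \<theta>: "\<theta> = e * (N1 / b1 + N2 / b2)" "\<theta> < 1"
    and t0: "t0 \<le> 0"
    and nonneg: "\<And>t. t \<le> t0 \<Longrightarrow> 0 \<le> u t"
    and bdd: "bounded (u ` {..t0})" and contu: "continuous_on {..t0} u"
    and ineq: "\<And>t. t \<le> t0 \<Longrightarrow> u t \<le>
            N2 * (E_conf a b2 t / E_conf a b2 t0)
          + e * N2 * E_conf a b2 t *
              integral {t..t0} (\<lambda>s. \<bar>s\<bar> powr (a - 1) * (u s / E_conf a b2 s))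
          + e * N1 / E_conf a b1 t *
              integral {..t} (\<lambda>s. \<bar>s\<bar> powr (a - 1) * E_conf a b1 s * u s)"
    and t: "t \<le> t0"
  shows "u t \<le> N2 / (1 - \<theta>) *
    (E_conf a (b2 - e * N2 / (1 - \<theta>)) t / E_conf a (b2 - e * N2 / (1 - \<theta>)) t0)"
proof -
  \<comment> \<open>The double negation presents the goal as the forward estimate for the reflected
    function at \<open>- t\<close>, with the indices 1 and 2 exchanged; \<open>\<theta>\<close> is
    symmetric in them.\<close>
  have "u (- (- t)) \<le> N2 / (1 - \<theta>) *
    (E_conf a (b2 - e * N2 / (1 - \<theta>)) (- t0) / E_conf a (b2 - e * N2 / (1 - \<theta>)) (- t))"
  proof (rule forward_decay[where u = "\<lambda>s. u (- s)" and ?N2.0 = N1 and ?b2.0 = b1])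
    have "(\<lambda>s. u (- s)) ` {- t0..} = u ` {..t0}"
      using image_image[of u uminus "{- t0..}"] by simp
    then show "bounded ((\<lambda>s. u (- s)) ` {- t0..})" using bdd by simp
    show "continuous_on {- t0..} (\<lambda>s. u (- s))"
      by (intro continuous_on_compose2[OF contu] continuous_intros) auto
  next
    fix r assume r: "- t0 \<le> r"
    have "integral {- t0..r} (\<lambda>s. \<bar>s\<bar> powr (a - 1) * E_conf a b2 s * u (- s)) =
        integral {- r..t0} (\<lambda>s. \<bar>s\<bar> powr (a - 1) * (u s / E_conf a b2 s))"
      using Henstock_Kurzweil_Integration.integral_reflect_real[of t0 "- r" "\<lambda>s. \<bar>s\<bar> powr (a - 1) * (u s / E_conf a b2 s)"]
      by (simp only: E_conf_minus abs_minus_cancel minus_minus divide_divide_eq_right div_by_1 mult_ac)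
    \<comment> \<open>On the half-line, reflection relies on \<open>u\<close> being nonnegative, as
      integrability is not among the hypotheses.\<close>
    moreover have "integral {r..} (\<lambda>s. \<bar>s\<bar> powr (a - 1) * (u (- s) / E_conf a b1 s)) =
        integral {..- r} (\<lambda>s. \<bar>s\<bar> powr (a - 1) * E_conf a b1 s * u s)"
      using integral_reflect_atMost_nonneg[of "- r" "\<lambda>s. \<bar>s\<bar> powr (a - 1) * E_conf a b1 s * u s"]
        r nonneg E_conf_pos[of a b1]
      by (simp add: E_conf_minus less_imp_le)
    ultimately show "u (- r) \<le> N2 * (E_conf a b2 (- t0) / E_conf a b2 r)
          + e * N2 / E_conf a b2 r *
              integral {- t0..r} (\<lambda>s. \<bar>s\<bar> powr (a - 1) * E_conf a b2 s * u (- s))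
          + e * N1 * E_conf a b1 r *
              integral {r..} (\<lambda>s. \<bar>s\<bar> powr (a - 1) * (u (- s) / E_conf a b1 s))"
      using ineq[of "- r"] r by (simp add: E_conf_minus mult_ac)
  qed (use assms in \<open>auto simp: add.commute\<close>)
  then show ?thesis by (simp add: E_conf_minus)
qed

theorem lemma3p2:
  fixes \<alpha> N1 N2 \<beta>1 \<beta>2 \<epsilon> \<theta> K1 K2 l1 l2 :: real
  assumes "0 < \<alpha>" and "\<alpha> \<le> 1"
    and "N1 > 0" and "N2 > 0" and "\<beta>1 > 0" and "\<beta>2 > 0" and "\<epsilon> > 0"
    and "\<theta> = \<epsilon> * (N1 / \<beta>1 + N2 / \<beta>2)"
    and "K1 = N1 / (1 - \<theta>)" and "K2 = N2 / (1 - \<theta>)"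
    and "l1 = \<beta>1 - \<epsilon> * N1 / (1 - \<theta>)" and "l2 = \<beta>2 - \<epsilon> * N2 / (1 - \<theta>)"
    and "\<theta> < 1"
  shows
    "(\<forall>(t0::real) (u::real \<Rightarrow> real).
        t0 \<ge> 0 \<longrightarrow>
        (\<forall>t\<ge>t0. u t \<ge> 0) \<longrightarrow> bounded (u ` {t0..}) \<longrightarrow> continuous_on {t0..} u \<longrightarrow>
        (\<forall>t\<ge>t0. u t \<le>
            N1 * (E_conf \<alpha> \<beta>1 t0 / E_conf \<alpha> \<beta>1 t)
          + \<epsilon> * N1 / E_conf \<alpha> \<beta>1 t *
              integral {t0..t} (\<lambda>s. \<bar>s\<bar> powr (\<alpha> - 1) * E_conf \<alpha> \<beta>1 s * u s)
          + \<epsilon> * N2 * E_conf \<alpha> \<beta>2 t *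
              integral {t..} (\<lambda>s. \<bar>s\<bar> powr (\<alpha> - 1) * (u s / E_conf \<alpha> \<beta>2 s))) \<longrightarrow>
        (\<forall>t\<ge>t0. u t \<le> K1 * (E_conf \<alpha> l1 t0 / E_conf \<alpha> l1 t)))
     \<and>
     (\<forall>(t0::real) (u::real \<Rightarrow> real).
        t0 \<le> 0 \<longrightarrow>
        (\<forall>t\<le>t0. u t \<ge> 0) \<longrightarrow> bounded (u ` {..t0}) \<longrightarrow> continuous_on {..t0} u \<longrightarrow>
        (\<forall>t\<le>t0. u t \<le>
            N2 * (E_conf \<alpha> \<beta>2 t / E_conf \<alpha> \<beta>2 t0)
          + \<epsilon> * N2 * E_conf \<alpha> \<beta>2 t *
              integral {t..t0} (\<lambda>s. \<bar>s\<bar> powr (\<alpha> - 1) * (u s / E_conf \<alpha> \<beta>2 s))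
          + \<epsilon> * N1 / E_conf \<alpha> \<beta>1 t *
              integral {..t} (\<lambda>s. \<bar>s\<bar> powr (\<alpha> - 1) * E_conf \<alpha> \<beta>1 s * u s)) \<longrightarrow>
        (\<forall>t\<le>t0. u t \<le> K2 * (E_conf \<alpha> l2 t / E_conf \<alpha> l2 t0)))"
proof (intro conjI allI impI)
  fix t0 t :: real and u :: "real \<Rightarrow> real"
  show "u t \<le> K1 * (E_conf \<alpha> l1 t0 / E_conf \<alpha> l1 t)"
    if "t0 \<ge> 0" "\<forall>t\<ge>t0. u t \<ge> 0" "bounded (u ` {t0..})" "continuous_on {t0..} u"
      "\<forall>t\<ge>t0. u t \<le>
            N1 * (E_conf \<alpha> \<beta>1 t0 / E_conf \<alpha> \<beta>1 t)
          + \<epsilon> * N1 / E_conf \<alpha> \<beta>1 t *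
              integral {t0..t} (\<lambda>s. \<bar>s\<bar> powr (\<alpha> - 1) * E_conf \<alpha> \<beta>1 s * u s)
          + \<epsilon> * N2 * E_conf \<alpha> \<beta>2 t *
              integral {t..} (\<lambda>s. \<bar>s\<bar> powr (\<alpha> - 1) * (u s / E_conf \<alpha> \<beta>2 s))"
      "t0 \<le> t"
    unfolding assms(9-12)
    by (rule forward_decay[OF assms(1,3-8,13)]) (use that in blast)+
  show "u t \<le> K2 * (E_conf \<alpha> l2 t / E_conf \<alpha> l2 t0)"
    if "t0 \<le> 0" "\<forall>t\<le>t0. u t \<ge> 0" "bounded (u ` {..t0})" "continuous_on {..t0} u"
      "\<forall>t\<le>t0. u t \<le>
            N2 * (E_conf \<alpha> \<beta>2 t / E_conf \<alpha> \<beta>2 t0)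
          + \<epsilon> * N2 * E_conf \<alpha> \<beta>2 t *
              integral {t..t0} (\<lambda>s. \<bar>s\<bar> powr (\<alpha> - 1) * (u s / E_conf \<alpha> \<beta>2 s))
          + \<epsilon> * N1 / E_conf \<alpha> \<beta>1 t *
              integral {..t} (\<lambda>s. \<bar>s\<bar> powr (\<alpha> - 1) * E_conf \<alpha> \<beta>1 s * u s)"
      "t \<le> t0"
    unfolding assms(9-12)
    by (rule backward_decay[OF assms(1,3-8,13)]) (use that in blast)+
qed

end
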